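(* For every integer $\ell\geq 1$ there is a graph $G$ of pathwidth $2$ with $\pi_l(G)\geq \ell$.
   Context: All graphs are finite, simple and undirected. A vertex coloring $\phi$ of a graph $G$ is nonrepetitive if there is no path (with no repeated vertices) $u_1u_2\ldots u_{2r}$, $r\geq 1$, in $G$ with $\phi(u_i)=\phi(u_{r+i})$ for all $i\in\{1,\dots,r\}$. Given lists $L_v$ ($v\in V(G)$) of colors, a coloring with these lists is a coloring $\phi$ with $\phi(v)\in L_v$ for all $v$. The Thue choice number $\pi_l(G)$ is the minimum $\ell$ such that for every assignment of lists $L_v$ with $|L_v|\geq \ell$ for all $v\in V(G)$ there is a nonrepetitive coloring of $G$ with these lists. Pathwidth is the usual notion: the minimum, over all path decompositions of $G$, of the maximum bag size minus one. *)

theory Defs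
  imports "Graph_Theory.Graph_Theory"
begin

text \<open>
  A finite simple undirected graph is a \<open>pair_graph\<close>: a finite, loopless, symmetric set of
  arcs, each undirected edge being represented by its two orientations.
\<close>

definition nonrepetitive :: "'a pair_pre_digraph \<Rightarrow> ('a \<Rightarrow> 'c) \<Rightarrow> bool" where
  "nonrepetitive G \<phi> \<longleftrightarrow>
     \<not> (\<exists>r u. r \<ge> 1 \<and> length u = 2 * r \<and> vpath u (with_proj G) \<and>
          (\<forall>i<r. \<phi> (u ! i) = \<phi> (u ! (r + i))))"

text \<open>
  Colors are natural numbers; this is no restriction, since a finite graph with finite lists
  involves only finitely many colors.
\<close>

definition nonrep_choosable :: "'a pair_pre_digraph \<Rightarrow> nat \<Rightarrow> bool" where
  "nonrep_choosable G l \<longleftrightarrow>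
     (\<forall>L :: 'a \<Rightarrow> nat set.
        (\<forall>v\<in>pverts G. finite (L v) \<and> card (L v) \<ge> l) \<longrightarrow>
        (\<exists>\<phi>. (\<forall>v\<in>pverts G. \<phi> v \<in> L v) \<and> nonrepetitive G \<phi>))"

definition thue_choice_number :: "'a pair_pre_digraph \<Rightarrow> nat" where
  "thue_choice_number G = (LEAST l. nonrep_choosable G l)"

definition path_decomposition :: "'a pair_pre_digraph \<Rightarrow> 'a set list \<Rightarrow> bool" where
  "path_decomposition G Bs \<longleftrightarrow>
     Bs \<noteq> [] \<and> \<Union>(set Bs) = pverts G \<and>
     (\<forall>(u, v)\<in>parcs G. \<exists>B\<in>set Bs. u \<in> B \<and> v \<in> B) \<and>
     (\<forall>i j k. i \<le> j \<and> j \<le> k \<and> k < length Bs \<longrightarrow> Bs ! i \<inter> Bs ! k \<subseteq> Bs ! j)"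

text \<open>
  The codomain is \<open>int\<close>, so that the graph without vertices has pathwidth \<open>-1\<close>
  instead of a truncated difference.
\<close>

definition pathwidth :: "'a pair_pre_digraph \<Rightarrow> int" where
  "pathwidth G =
     int (LEAST k. \<exists>Bs. path_decomposition G Bs \<and> k = Max (card ` set Bs)) - 1"

text \<open>Both minima range over nonempty sets.\<close>

lemma nonrep_choosable_card:
  assumes "finite (pverts G)"
  shows "nonrep_choosable G (card (pverts G))"
  unfolding nonrep_choosable_def
proof (intro allI impI)
  fix L :: "'a \<Rightarrow> nat set"
  assume L: "\<forall>v\<in>pverts G. finite (L v) \<and> card (pverts G) \<le> card (L v)"
  have "\<exists>\<phi>. (\<forall>v\<in>S. \<phi> v \<in> L v) \<and> inj_on \<phi> S" if "S \<subseteq> pverts G" for S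
    using finite_subset[OF that assms] that
  proof (induction S rule: finite_induct)
    case empty
    show ?case by simp
  next
    case (insert x S)
    then obtain \<phi> where \<phi>: "\<forall>v\<in>S. \<phi> v \<in> L v" "inj_on \<phi> S" by auto
    have "card (\<phi> ` S) \<le> card S" using insert by (simp add: card_image_le)
    also have "\<dots> < card (insert x S)" using insert by simp
    also have "\<dots> \<le> card (pverts G)" using insert assms by (intro card_mono) auto
    also have "\<dots> \<le> card (L x)" using L insert by auto
    finally have "\<not> L x \<subseteq> \<phi> ` S"
      using insert by (meson card_mono finite_imageI not_less)
    then obtain c where c: "c \<in> L x" "c \<notin> \<phi> ` S" by auto
    have "(\<forall>v\<in>insert x S. (\<phi>(x := c)) v \<in> L v) \<and> inj_on (\<phi>(x := c)) (insert x S)"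
      using \<phi> c insert by (auto simp: inj_on_def)
    then show ?case by blast
  qed
  then obtain \<phi> where \<phi>: "\<forall>v\<in>pverts G. \<phi> v \<in> L v" "inj_on \<phi> (pverts G)" by blast
  have "nonrepetitive G \<phi>"
    unfolding nonrepetitive_def
  proof (intro notI, elim exE conjE)
    fix r u
    assume r: "r \<ge> 1" "length u = 2 * r" and p: "vpath u (with_proj G)"
      and eq: "\<forall>i<r. \<phi> (u ! i) = \<phi> (u ! (r + i))"
    have "set u \<subseteq> pverts G" "distinct u" using p by (auto simp: vpath_def vwalk_def)
    have "u ! 0 \<in> pverts G" "u ! r \<in> pverts G"
      using \<open>set u \<subseteq> pverts G\<close> r by (auto intro!: subsetD[OF _ nth_mem])
    moreover have "\<phi> (u ! 0) = \<phi> (u ! r)" using eq r by (auto dest: spec[of _ 0])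
    ultimately have "u ! 0 = u ! r" using \<phi>(2) by (simp add: inj_on_eq_iff)
    then show False using \<open>distinct u\<close> r by (simp add: nth_eq_iff_index_eq)
  qed
  with \<phi> show "\<exists>\<phi>. (\<forall>v\<in>pverts G. \<phi> v \<in> L v) \<and> nonrepetitive G \<phi>" by blast
qed

lemma path_decomposition_single:
  assumes "pair_graph G"
  shows "path_decomposition G [pverts G]"
proof -
  interpret pair_graph G by fact
  show ?thesis by (auto simp: path_decomposition_def dest: in_arcsD1 in_arcsD2)
qed

end

theory Submission
  imports Defs "HOL-Analysis.Harmonic_Numbers"
begin

text \<open>
  Take hubs \<open>v\<^sub>0, \<dots>, v\<^sub>n\<close> and join consecutive hubs \<open>v\<^sub>i, v\<^sub>i\<^sub>+\<^sub>1\<close> by an edge and by many paths of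
  length two, one for each \<open>l\<close>-subset of the palette, whose middle vertex gets that subset as its
  list. In any colouring from the lists, the set \<open>D\<^sub>i\<close> of colours missing in the \<open>i\<close>-th gap has fewer
  than \<open>l\<close> elements. The hubs have pairwise disjoint lists. A path
  \<open>v\<^sub>s w\<^sub>s v\<^sub>s\<^sub>+\<^sub>1 w\<^sub>s\<^sub>+\<^sub>1 \<dots> v\<^sub>s\<^sub>+\<^sub>2\<^sub>m w\<^sub>s\<^sub>+\<^sub>2\<^sub>m\<close> has halves of odd length \<open>2m + 1\<close>, so a repetition matches hubs with
  middle vertices, and the latter can be chosen freely among the colours outside \<open>D\<^sub>i\<close>. Hence, if
  there is no repetition, every window \<open>s, \<dots>, s + m\<close> contains some \<open>j\<close> such that the colour of \<open>v\<^sub>j\<close> is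
  in \<open>D\<^sub>j\<^sub>+\<^sub>m\<close> or the colour of \<open>v\<^sub>j\<^sub>+\<^sub>m\<^sub>+\<^sub>1\<close> is in \<open>D\<^sub>j\<close>. For each \<open>m\<close> this gives about \<open>n / (m + 1)\<close>
  incidences, which are distinct for different \<open>m\<close>, so there are about \<open>n log n\<close> in total; but
  there are fewer than \<open>n l\<close>.
\<close>

section \<open>Counting incidences against the harmonic sum\<close>

text \<open>In the application, \<open>X i\<close> consists of the hubs whose colour is missing in
  gap \<open>i\<close>.\<close>

lemma exists_incidence_free_window:
  fixes X :: "nat \<Rightarrow> nat set"
  assumes X: "\<And>i. i < n \<Longrightarrow> finite (X i) \<and> card (X i) \<le> l"
    and harm: "real l + 1 < harm M" and n: "2 * M \<le> n" "0 < n"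
  shows "\<exists>s m. s + 2 * m < n \<and> (\<forall>j\<in>{s..s + m}. j \<notin> X (j + m)) \<and>
           (\<forall>j\<in>{s..<s + m}. j + m + 1 \<notin> X j)"
proof (rule ccontr)
  assume "\<not> ?thesis"
  then have window: "(\<exists>j\<in>{s..s + m}. j \<in> X (j + m)) \<or> (\<exists>j\<in>{s..<s + m}. j + m + 1 \<in> X j)"
    if "s + 2 * m < n" for s m
    using that by blast
  define P where "P = (SIGMA i:{..<n}. X i)"
  \<comment> \<open>The integer \<open>i - x\<close> determines \<open>m\<close>: it equals
    \<open>m\<close> in the first case and \<open>-(m + 1)\<close> in the second. Hence the
    \<open>Q m\<close> are pairwise disjoint.\<close>
  define Q where "Q m = {(i, x) \<in> P. x + m = i \<or> x = i + m + 1}" for m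
  have finP: "finite P" unfolding P_def using X by auto
  have "card P = (\<Sum>i<n. card (X i))" unfolding P_def using X by (intro card_SigmaI) auto
  also have "\<dots> \<le> (\<Sum>i<n. l)" by (intro sum_mono) (use X in auto)
  finally have cardP: "card P \<le> n * l" by simp
  have finQ: "finite (Q m)" for m
    using finP by (rule rev_finite_subset) (auto simp: Q_def)
  have "(\<Sum>m<M. card (Q m)) = card (\<Union>m<M. Q m)"
    by (intro card_UN_disjoint[symmetric]) (auto simp: finQ, auto simp: Q_def)
  also have "\<dots> \<le> card P" by (intro card_mono finP) (auto simp: Q_def)
  finally have upper: "(\<Sum>m<M. card (Q m)) \<le> n * l" using cardP by simp
  have lower: "n div Suc m - 1 \<le> card (Q m)" for m
  proof -
    \<comment> \<open>Windows starting at multiples of \<open>Suc m\<close> are disjoint, and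
      \<open>min i x\<close> is the witness \<open>j\<close> in its window, so division by
      \<open>Suc m\<close> recovers the window number \<open>k\<close>. The subtracted 1 guarantees
      \<open>s + 2 * m < n\<close>.\<close>
    have "{..<n div Suc m - 1} \<subseteq> (\<lambda>(i, x). min i x div Suc m) ` Q m"
    proof
      fix k assume "k \<in> {..<n div Suc m - 1}"
      then have "k + 2 \<le> n div Suc m" by auto
      then have "(k + 2) * Suc m \<le> n div Suc m * Suc m" by (rule mult_le_mono1)
      also have "\<dots> \<le> n" by (rule div_times_less_eq_dividend)
      finally have s: "k * Suc m + 2 * m < n" by simp
      have k: "j div Suc m = k" if "j \<in> {k * Suc m..k * Suc m + m}" for j
        using that by (intro div_nat_eqI) (auto simp: algebra_simps)
      from window[OF s] show "k \<in> (\<lambda>(i, x). min i x div Suc m) ` Q m"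
      proof
        assume "\<exists>j\<in>{k * Suc m..k * Suc m + m}. j \<in> X (j + m)"
        then obtain j where j: "j \<in> {k * Suc m..k * Suc m + m}" "j \<in> X (j + m)" by blast
        then have "(j + m, j) \<in> Q m" using s by (auto simp: Q_def P_def)
        then show ?thesis using k[OF j(1)] by (force simp: min_def)
      next
        assume "\<exists>j\<in>{k * Suc m..<k * Suc m + m}. j + m + 1 \<in> X j"
        then obtain j where j: "j \<in> {k * Suc m..<k * Suc m + m}" "j + m + 1 \<in> X j" by blast
        then have "(j, j + m + 1) \<in> Q m" using s by (auto simp: Q_def P_def)
        moreover have "j div Suc m = k" using j(1) by (intro k) auto
        ultimately show ?thesis by (force simp: min_def)
      qed
    qed
    from card_mono[OF _ this] finQ[of m] have
      "n div Suc m - 1 \<le> card ((\<lambda>(i, x). min i x div Suc m) ` Q m)" by simp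
    also have "\<dots> \<le> card (Q m)" by (rule card_image_le[OF finQ])
    finally show ?thesis .
  qed
  \<comment> \<open>Rounding costs one and the dropped window another. Over all \<open>m < M\<close>
    the loss is \<open>2 * M \<le> n\<close>, which the \<open>+ 1\<close> in the bound on
    \<open>harm M\<close> absorbs.\<close>
  have "real n * inverse (real (Suc m)) - 2 \<le> card (Q m)" for m
  proof -
    have "real n / real (Suc m) \<le> real (n div Suc m) + 1"
      using floor_divide_of_nat_eq[of n "Suc m", where 'a = real] by linarith
    then show ?thesis using lower[of m] by (simp add: divide_inverse)
  qed
  then have "(\<Sum>m<M. real n * inverse (real (Suc m)) - 2) \<le> (\<Sum>m<M. real (card (Q m)))"
    by (intro sum_mono)
  also have "\<dots> \<le> real n * real l"
    using upper by (metis of_nat_le_iff of_nat_mult of_nat_sum)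
  also have "(\<Sum>m<M. real n * inverse (real (Suc m)) - 2) = real n * harm M - 2 * real M"
    unfolding harm_def One_nat_def sum.atLeast_Suc_atMost_Suc_shift sum.atLeast1_atMost_eq
    by (simp add: sum_subtractf sum_distrib_left)
  finally have "real n * harm M \<le> real n * real l + 2 * real M" by simp
  also have "\<dots> \<le> real n * (real l + 1)" using n by (simp add: algebra_simps)
  finally show False using harm n by simp
qed

section \<open>Path decompositions and pathwidth 2\<close>

text \<open>With bags turned into cliques, only the interval condition remains to be checked for a
  path decomposition.\<close>

definition clique_union :: "'a set list \<Rightarrow> 'a pair_pre_digraph" where
  "clique_union Bs = \<lparr>pverts = \<Union>(set Bs),
     parcs = {(u, v). u \<noteq> v \<and> (\<exists>B\<in>set Bs. u \<in> B \<and> v \<in> B)}\<rparr>"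

lemma pair_graph_clique_union:
  assumes "\<And>B. B \<in> set Bs \<Longrightarrow> finite B"
  shows "pair_graph (clique_union Bs)"
proof
  have "parcs (clique_union Bs) \<subseteq> \<Union>(set Bs) \<times> \<Union>(set Bs)"
    by (auto simp: clique_union_def)
  then show "finite (parcs (clique_union Bs))"
    by (rule finite_subset) (use assms in auto)
  show "symmetric (with_proj (clique_union Bs))"
    by (auto simp: symmetric_def clique_union_def intro!: symI)
qed (use assms in \<open>auto simp: clique_union_def\<close>)

lemma path_decomposition_clique_union:
  assumes "Bs \<noteq> []"
    and "\<And>i j k. i \<le> j \<Longrightarrow> j \<le> k \<Longrightarrow> k < length Bs \<Longrightarrow> Bs ! i \<inter> Bs ! k \<subseteq> Bs ! j"
  shows "path_decomposition (clique_union Bs) Bs"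
  using assms by (auto simp: path_decomposition_def clique_union_def)

text \<open>Helly property: the bag positions of the three vertices form pairwise intersecting
  intervals.\<close>

lemma path_decomposition_triangle:
  assumes dec: "path_decomposition G Bs"
    and "(a, b) \<in> parcs G" "(b, c) \<in> parcs G" "(a, c) \<in> parcs G"
  shows "\<exists>B\<in>set Bs. {a, b, c} \<subseteq> B"
proof -
  have edge: "\<exists>i<length Bs. u \<in> Bs ! i \<and> v \<in> Bs ! i" if "(u, v) \<in> parcs G" for u v
    using dec that unfolding path_decomposition_def by (fastforce simp: in_set_conv_nth)
  obtain i where i: "i < length Bs" "a \<in> Bs ! i" "b \<in> Bs ! i" using edge assms(2) by blast
  obtain j where j: "j < length Bs" "b \<in> Bs ! j" "c \<in> Bs ! j" using edge assms(3) by blast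
  obtain k where k: "k < length Bs" "a \<in> Bs ! k" "c \<in> Bs ! k" using edge assms(4) by blast
  have between: "x \<in> Bs ! s" if "x \<in> Bs ! r" "x \<in> Bs ! t" "r \<le> s \<and> s \<le> t" "t < length Bs"
    for x r s t
    using dec that unfolding path_decomposition_def by blast
  \<comment> \<open>The median of the three positions is a bag containing all three vertices.\<close>
  consider "j \<le> i \<and> i \<le> k \<or> k \<le> i \<and> i \<le> j" | "i \<le> j \<and> j \<le> k \<or> k \<le> j \<and> j \<le> i"
    | "i \<le> k \<and> k \<le> j \<or> j \<le> k \<and> k \<le> i"
    by linarith
  then show ?thesis
  proof cases
    case 1
    then have "c \<in> Bs ! i" using between[of c j k i] between[of c k j i] j k by blast
    then show ?thesis using i by (auto intro!: bexI[of _ "Bs ! i"])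
  next
    case 2
    then have "a \<in> Bs ! j" using between[of a i k j] between[of a k i j] i k by blast
    then show ?thesis using j by (auto intro!: bexI[of _ "Bs ! j"])
  next
    case 3
    then have "b \<in> Bs ! k" using between[of b i j k] between[of b j i k] i j by blast
    then show ?thesis using k by (auto intro!: bexI[of _ "Bs ! k"])
  qed
qed

lemma pathwidth_eq_2I:
  assumes "finite (pverts G)"
    and dec: "path_decomposition G Bs" and card: "\<And>B. B \<in> set Bs \<Longrightarrow> card B \<le> 3"
    and tri: "(a, b) \<in> parcs G" "(b, c) \<in> parcs G" "(a, c) \<in> parcs G" "distinct [a, b, c]"
  shows "pathwidth G = 2"
proof -
  have "3 \<le> Max (card ` set Cs)" if Cs: "path_decomposition G Cs" for Cs
  proof -
    obtain B where B: "B \<in> set Cs" "{a, b, c} \<subseteq> B"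
      using path_decomposition_triangle[OF Cs tri(1-3)] by blast
    have "finite B"
      using Cs B assms(1) by (auto simp: path_decomposition_def intro: finite_subset)
    then have "card {a, b, c} \<le> card B" using B by (intro card_mono)
    also have "\<dots> \<le> Max (card ` set Cs)" using B by (intro Max_ge) auto
    finally show ?thesis using tri(4) by simp
  qed
  moreover have "Max (card ` set Bs) \<le> 3"
    using dec card by (subst Max_le_iff) (auto simp: path_decomposition_def)
  ultimately have "(LEAST k. \<exists>Bs. path_decomposition G Bs \<and> k = Max (card ` set Bs)) = 3"
    using dec by (intro Least_equality) (auto intro!: exI[of _ Bs] antisym)
  then show ?thesis by (simp add: pathwidth_def)
qed

section \<open>Walks and choosability\<close>

lemma set_vwalk_arcs_conv_nth:
  "set (vwalk_arcs u) = {(u ! a, u ! Suc a) | a. Suc a < length u}"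
proof (induction u rule: vwalk_arcs.induct)
  case (3 x y xs)
  have "(\<exists>a. P a) \<longleftrightarrow> P 0 \<or> (\<exists>a. P (Suc a))" for P :: "nat \<Rightarrow> bool"
    by (metis not0_implies_Suc)
  from this[where P = "\<lambda>a. e = ((x # y # xs) ! a, (x # y # xs) ! Suc a) \<and>
        Suc a < length (x # y # xs)" for e]
  show ?case unfolding vwalk_arcs.simps list.set 3 by auto
qed auto

lemma nonrep_choosable_mono:
  assumes "nonrep_choosable G k" "k \<le> l"
  shows "nonrep_choosable G l"
  unfolding nonrep_choosable_def
proof (intro allI impI)
  fix L :: "'a \<Rightarrow> nat set"
  assume "\<forall>v\<in>pverts G. finite (L v) \<and> l \<le> card (L v)"
  then have "\<forall>v\<in>pverts G. finite (L v) \<and> k \<le> card (L v)" using assms(2) by auto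
  then show "\<exists>\<phi>. (\<forall>v\<in>pverts G. \<phi> v \<in> L v) \<and> nonrepetitive G \<phi>"
    using assms(1) unfolding nonrep_choosable_def by blast
qed

text \<open>The minimum is attained, and by monotonicity it cannot be attained at or below a failing
  list size.\<close>

lemma less_thue_choice_number:
  assumes "finite (pverts G)" "\<not> nonrep_choosable G l"
  shows "l < thue_choice_number G"
proof -
  have "nonrep_choosable G (thue_choice_number G)"
    unfolding thue_choice_number_def using nonrep_choosable_card[OF assms(1)] by (rule LeastI)
  then show ?thesis using nonrep_choosable_mono assms(2) not_le by blast
qed

section \<open>The thickened path\<close>

text \<open>
  The hub \<open>v\<^sub>i\<close> is the vertex \<open>p * i\<close>, and the vertices strictly between \<open>p * i\<close> and
  \<open>p * i + p\<close> are the middle vertices of the paths of length two joining \<open>v\<^sub>i\<close> to \<open>v\<^sub>i\<^sub>+\<^sub>1\<close>.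
\<close>

definition thick_bag :: "nat \<Rightarrow> nat \<Rightarrow> nat set" where
  "thick_bag p x = {p * (x div p), x, p * (x div p) + p}"

text \<open>A middle vertex \<open>x\<close> contributes a triangle, a hub \<open>x\<close> only the
  edge to the next hub. There are \<open>n\<close> gaps, so for \<open>n > 0\<close> the last hub is
  \<open>p * n\<close>.\<close>

definition thick_path :: "nat \<Rightarrow> nat \<Rightarrow> nat pair_pre_digraph" where
  "thick_path n p = clique_union (map (thick_bag p) [0..<n * p])"

lemma pair_graph_thick_path: "pair_graph (thick_path n p)"
  unfolding thick_path_def by (rule pair_graph_clique_union) (auto simp: thick_bag_def)

text \<open>A hub \<open>p * q\<close> lies exactly in the bags of the adjacent gaps
  \<open>q - 1\<close> and \<open>q\<close>, and a middle vertex only in its own bag.\<close>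

lemma thick_bag_interval:
  assumes "0 < p" "i \<le> j" "j \<le> k"
  shows "thick_bag p i \<inter> thick_bag p k \<subseteq> thick_bag p j"
proof
  fix y assume y: "y \<in> thick_bag p i \<inter> thick_bag p k"
  have le: "i div p \<le> j div p" "j div p \<le> k div p" using assms by (auto intro: div_le_mono)
  show "y \<in> thick_bag p j"
  proof (cases "p dvd y")
    case True
    then obtain q where q: "y = p * q" by blast
    have iff: "y \<in> thick_bag p x \<longleftrightarrow> q = x div p \<or> q = x div p + 1" for x
    proof -
      have "p * (x div p) + p = p * (x div p + 1)" by simp
      then show ?thesis unfolding thick_bag_def q using assms(1)
        by (metis insert_iff mult_cancel1 nonzero_mult_div_cancel_left less_not_refl3 empty_iff)
    qed
    show ?thesis using y le unfolding Int_iff iff by linarith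
  next
    case False
    then have "y = i" "y = k" using y by (auto simp: thick_bag_def)
    then show ?thesis using assms by (simp add: thick_bag_def)
  qed
qed

lemma thick_bag_arc:
  assumes "x < n * p" "u \<in> thick_bag p x" "v \<in> thick_bag p x" "u \<noteq> v"
  shows "(u, v) \<in> parcs (thick_path n p)"
  using assms by (auto simp: thick_path_def clique_union_def)

lemma pathwidth_thick_path:
  assumes "0 < n" "2 \<le> p"
  shows "pathwidth (thick_path n p) = 2"
proof (rule pathwidth_eq_2I)
  interpret pair_graph "thick_path n p" by (rule pair_graph_thick_path)
  show "finite (pverts (thick_path n p))" by simp
  show "path_decomposition (thick_path n p) (map (thick_bag p) [0..<n * p])"
    unfolding thick_path_def
    by (rule path_decomposition_clique_union) (use assms thick_bag_interval in auto)
  show "card B \<le> 3" if "B \<in> set (map (thick_bag p) [0..<n * p])" for B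
    using that by (auto simp: thick_bag_def card_insert_if)
  have 1: "1 < n * p" using mult_le_mono[of 1 n 2 p] assms by simp
  have bag: "thick_bag p 1 = {0, 1, p}" using assms by (simp add: thick_bag_def)
  show "(0, 1) \<in> parcs (thick_path n p)" "(1, p) \<in> parcs (thick_path n p)"
      "(0, p) \<in> parcs (thick_path n p)" "distinct [0, 1, p]"
    using assms by (auto intro!: thick_bag_arc[OF 1] simp: bag[simplified])
qed

lemma thick_path_arcs:
  assumes "i < n" "0 < t" "t < p"
  shows "(p * i, p * i + t) \<in> parcs (thick_path n p)"
    and "(p * i + t, p * i + p) \<in> parcs (thick_path n p)"
proof -
  have "p * i + t < p * Suc i" using assms by simp
  also have "\<dots> \<le> p * n" using assms by (intro mult_le_mono2) simp
  finally have "p * i + t < n * p" by (simp add: mult.commute)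
  moreover have "thick_bag p (p * i + t) = {p * i, p * i + t, p * i + p}"
    using assms by (simp add: thick_bag_def)
  ultimately show "(p * i, p * i + t) \<in> parcs (thick_path n p)"
    "(p * i + t, p * i + p) \<in> parcs (thick_path n p)"
    using assms by (auto intro!: thick_bag_arc[of "p * i + t"])
qed

text \<open>Even positions are hubs, odd positions the middle vertices selected by \<open>t\<close>.
  Vertex numbers increase along the walk, so no vertex repeats.\<close>

lemma thick_path_vpath:
  assumes "s + k \<le> n" "0 < k" and t: "\<And>i. i < n \<Longrightarrow> 0 < t i \<and> t i < p"
  shows "vpath (map (\<lambda>a. p * (s + a div 2) + (if even a then 0 else t (s + a div 2))) [0..<2 * k])
           (with_proj (thick_path n p))"
proof -
  interpret pair_graph "thick_path n p" by (rule pair_graph_thick_path)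
  define f where "f a = p * (s + a div 2) + (if even a then 0 else t (s + a div 2))" for a
  have gap: "s + a div 2 < n" if "a < 2 * k" for a using that assms(1) by auto
  have arc: "(f a, f (Suc a)) \<in> parcs (thick_path n p)" if "a < 2 * k" for a
    using thick_path_arcs[OF gap[OF that], of "t (s + a div 2)" p] t[OF gap[OF that]]
    by (auto simp: f_def algebra_simps)
  have step: "f a < f (Suc a)" if "a < 2 * k" for a
    using t[OF gap[OF that]] by (auto simp: f_def algebra_simps)
  have "sorted_wrt (<) (map f [0..<2 * k])"
    using step by (simp add: sorted_wrt_iff_nth_Suc_transp)
  then have "distinct (map f [0..<2 * k])" by (simp only: strict_sorted_iff)
  moreover have "set (map f [0..<2 * k]) \<subseteq> pverts (thick_path n p)"
    using in_arcsD1[OF arc] by auto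
  moreover have "set (vwalk_arcs (map f [0..<2 * k])) \<subseteq> parcs (thick_path n p)"
    unfolding set_vwalk_arcs_conv_nth using arc by auto
  ultimately have "vpath (map f [0..<2 * k]) (with_proj (thick_path n p))"
    using assms(2) by (intro vpathI vwalkI) auto
  then show ?thesis unfolding f_def .
qed

section \<open>Lists that force a repetition\<close>

lemma not_nonrep_choosable_thick_path:
  fixes l :: nat
  assumes harm: "real l + 1 < harm M" and n: "n = 2 * M" "0 < n"
    and p: "p = Suc (((n + 1) * l) choose l)"
  shows "\<not> nonrep_choosable (thick_path n p) l"
proof
  assume choosable: "nonrep_choosable (thick_path n p) l"
  \<comment> \<open>The palette is the union of \<open>n + 1\<close> blocks of \<open>l\<close>
    colours, one block per hub; \<open>p - 1\<close> counts its \<open>l\<close>-subsets.\<close>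
  define S where "S = {..<(n + 1) * l}"
  have "finite S" by (simp add: S_def)
  then have "card {A. A \<subseteq> S \<and> card A = l} = card S choose l" by (rule n_subsets)
  then have "card {1..<p} = card {A. A \<subseteq> S \<and> card A = l}" by (simp add: p S_def)
  then obtain T where T: "bij_betw T {1..<p} {A. A \<subseteq> S \<and> card A = l}"
    using finite_same_card_bij[of "{1..<p}" "{A. A \<subseteq> S \<and> card A = l}"] \<open>finite S\<close>
    by auto
  define L where "L x = (if p dvd x then {x div p * l..<x div p * l + l} else T (x mod p))" for x
  have "finite (L x) \<and> card (L x) \<ge> l" for x
  proof (cases "p dvd x")
    case False
    then have "x mod p \<in> {1..<p}" using p by (auto simp: dvd_eq_mod_eq_0)
    then have "T (x mod p) \<subseteq> S \<and> card (T (x mod p)) = l" using bij_betw_apply[OF T] by simp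
    then show ?thesis using False \<open>finite S\<close> finite_subset by (auto simp: L_def)
  qed (simp add: L_def)
  then obtain \<phi> where \<phi>: "\<forall>x\<in>pverts (thick_path n p). \<phi> x \<in> L x"
    and nonrep: "nonrepetitive (thick_path n p) \<phi>"
    using choosable[unfolded nonrep_choosable_def, rule_format, of L] by blast
  have gap_verts: "p * i + t \<in> pverts (thick_path n p)" "p * i \<in> pverts (thick_path n p)"
      "p * i + p \<in> pverts (thick_path n p)" if "i < n" "0 < t" "t < p" for i t
  proof -
    interpret pair_graph "thick_path n p" by (rule pair_graph_thick_path)
    show "p * i + t \<in> pverts (thick_path n p)" "p * i \<in> pverts (thick_path n p)"
      "p * i + p \<in> pverts (thick_path n p)"
      using in_arcsD1[OF thick_path_arcs(2)[OF that]] in_arcsD1[OF thick_path_arcs(1)[OF that]]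
        in_arcsD2[OF thick_path_arcs(2)[OF that]] .
  qed
  have "l \<le> (n + 1) * l" by simp
  then have p2: "1 < p" using p by (simp add: zero_less_binomial)
  have hub: "\<phi> (p * i) \<in> {i * l..<i * l + l}" if "i \<le> n" for i
  proof -
    have "p * i \<in> pverts (thick_path n p)"
    proof (cases "i < n")
      case False
      then have "p * i = p * (n - 1) + p" using that n(2) by (cases n) auto
      then show ?thesis using gap_verts(3)[of "n - 1" 1] n p2 by simp
    qed (use gap_verts(2)[of i 1] p2 in auto)
    then have "\<phi> (p * i) \<in> L (p * i)" using \<phi> by blast
    then show ?thesis using p2 by (simp add: L_def)
  qed
  have hub_div: "\<phi> (p * i) div l = i" if "i \<le> n" for i
    using hub[OF that] by (intro div_nat_eqI) (auto simp: algebra_simps)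
  have hub_S: "\<phi> (p * i) \<in> S" if "i \<le> n" for i
  proof -
    have "\<phi> (p * i) < i * l + l" using hub[OF that] by simp
    also have "\<dots> \<le> n * l + l" using mult_le_mono1[OF that, of l] by simp
    finally show ?thesis by (simp add: S_def)
  qed
  define D where "D i = S - (\<lambda>t. \<phi> (p * i + t)) ` {1..<p}" for i
  have D: "card (D i) < l" if "i < n" for i
  proof (rule ccontr)
    assume "\<not> card (D i) < l"
    \<comment> \<open>Such an \<open>A\<close> is the list of some middle vertex of gap
      \<open>i\<close>, whose colour would then be both present and missing there.\<close>
    then obtain A where A: "A \<subseteq> D i" "card A = l" by (meson not_less obtain_subset_with_card_n)
    then have "A \<in> {A. A \<subseteq> S \<and> card A = l}" by (auto simp: D_def)
    then obtain t where t: "t \<in> {1..<p}" "T t = A" using T by (metis bij_betw_iff_bijections)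
    have "\<phi> (p * i + t) \<in> L (p * i + t)" using \<phi> gap_verts(1)[OF that] t by auto
    moreover have "\<not> p dvd p * i + t" using t by (auto simp: dvd_eq_mod_eq_0)
    ultimately have "\<phi> (p * i + t) \<in> A" using t by (simp add: L_def)
    then show False using A t by (auto simp: D_def)
  qed
  \<comment> \<open>Since hub lists are disjoint, a hub's colour determines its index, so the bound
    on \<open>D i\<close> carries over to \<open>X i\<close>.\<close>
  define X where "X i = {x. x \<le> n \<and> \<phi> (p * x) \<in> D i}" for i
  have X: "finite (X i) \<and> card (X i) \<le> l" if "i < n" for i
  proof
    show "finite (X i)" by (simp add: X_def)
    have "inj_on (\<lambda>x. \<phi> (p * x)) (X i)"
      by (rule inj_on_inverseI[where g = "\<lambda>c. c div l"]) (simp add: X_def hub_div)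
    then have "card (X i) \<le> card (D i)"
      by (rule card_inj_on_le) (auto simp: X_def D_def S_def)
    then show "card (X i) \<le> l" using D[OF that] by simp
  qed
  have "2 * M \<le> n" using n by simp
  from exists_incidence_free_window[of n X, OF X harm this n(2)]
  obtain s m where sm: "s + 2 * m < n" "\<And>j. j \<in> {s..s + m} \<Longrightarrow> j \<notin> X (j + m)"
      "\<And>j. j \<in> {s..<s + m} \<Longrightarrow> j + m + 1 \<notin> X j"
    by blast
  have avail: "\<exists>t\<in>{1..<p}. \<phi> (p * i + t) = \<phi> (p * x)" if "x \<le> n" "x \<notin> X i" for i x
    using that hub_S[OF that(1)] by (auto simp: X_def D_def)
  \<comment> \<open>The hub \<open>2 * m + 1\<close> positions away from the middle vertex of gap
    \<open>i\<close>: ahead if that vertex is in the first half of the path, behind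
    otherwise.\<close>
  define partner where "partner i = (if i < s + m then i + m + 1 else i - m)" for i
  \<comment> \<open>Gaps off the path get an arbitrary middle vertex, so that \<open>t\<close> is
    total.\<close>
  have "\<exists>t\<in>{1..<p}. i \<in> {s..s + 2 * m} \<longrightarrow> \<phi> (p * i + t) = \<phi> (p * partner i)" for i
  proof (cases "i \<in> {s..s + 2 * m}")
    case True
    have "partner i \<notin> X i"
    proof (cases "i < s + m")
      case False
      then have "i - m \<in> {s..s + m}" "i - m + m = i" using True by auto
      then show ?thesis using sm(2)[of "i - m"] False by (simp add: partner_def)
    qed (use True sm(3)[of i] in \<open>auto simp: partner_def\<close>)
    moreover have "partner i \<le> n" using True sm(1) by (auto simp: partner_def)
    ultimately show ?thesis using avail by blast
  qed (use p2 in auto)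
  then obtain t where t: "\<And>i. t i \<in> {1..<p}"
      "\<And>i. i \<in> {s..s + 2 * m} \<Longrightarrow> \<phi> (p * i + t i) = \<phi> (p * partner i)"
    by metis
  define f where "f a = p * (s + a div 2) + (if even a then 0 else t (s + a div 2))" for a
  define u where "u = map f [0..<2 * (2 * m + 1)]"
  have "0 < t i \<and> t i < p" for i using t(1)[of i] by auto
  then have "vpath u (with_proj (thick_path n p))"
    unfolding u_def f_def using sm(1) by (intro thick_path_vpath) auto
  moreover have "\<phi> (u ! a) = \<phi> (u ! (2 * m + 1 + a))" if "a < 2 * m + 1" for a
  proof -
    have u: "u ! b = f b" if "b < 2 * (2 * m + 1)" for b
      using that nth_map_upt[of b "2 * (2 * m + 1)" 0 f] by (simp only: u_def) simp
    have "\<phi> (f a) = \<phi> (f (2 * m + 1 + a))"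
    proof (cases "even a")
      case True
      then obtain i where i: "a = 2 * i" by blast
      have "f a = p * (s + i)" using i by (simp add: f_def)
      moreover have "f (2 * m + 1 + a) = p * (s + m + i) + t (s + m + i)"
        using i by (simp add: f_def add.assoc)
      moreover have "\<phi> (p * (s + m + i) + t (s + m + i)) = \<phi> (p * (s + i))"
        using that i t(2)[of "s + m + i"] by (simp add: partner_def)
      ultimately show ?thesis by metis
    next
      case False
      then obtain i where i: "a = 2 * i + 1" by (blast elim: oddE)
      have "f a = p * (s + i) + t (s + i)" using i by (simp add: f_def)
      moreover have "2 * m + 1 + a = 2 * (m + i + 1)" using i by simp
      then have "f (2 * m + 1 + a) = p * (s + i + m + 1)"
        unfolding f_def by (simp only:) (simp add: algebra_simps)
      moreover have "\<phi> (p * (s + i) + t (s + i)) = \<phi> (p * (s + i + m + 1))"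
        using that i t(2)[of "s + i"] by (simp add: partner_def)
      ultimately show ?thesis by metis
    qed
    then show ?thesis using u[of a] u[of "2 * m + 1 + a"] that by simp
  qed
  moreover have "length u = 2 * (2 * m + 1)" "1 \<le> 2 * m + 1" by (simp_all add: u_def)
  ultimately show False using nonrep unfolding nonrepetitive_def by blast
qed

theorem theorem1:
  fixes l :: nat
  assumes "l \<ge> 1"
  shows "\<exists>G :: nat pair_pre_digraph.
           pair_graph G \<and> pathwidth G = 2 \<and> thue_choice_number G \<ge> l"
proof -
  \<comment> \<open>The harmonic series diverges, so its partial sums exceed any list size.\<close>
  have "eventually (\<lambda>M. real l + 1 < harm M) sequentially"
    using harm_at_top by (simp add: filterlim_at_top_dense)
  then obtain M where M: "real l + 1 < harm M" by (auto simp: eventually_sequentially)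
  then have "0 < M" by (cases M) (auto simp: harm_def)
  define n where "n = 2 * M"
  define p where "p = Suc (((n + 1) * l) choose l)"
  have "0 < n" using \<open>0 < M\<close> by (simp add: n_def)
  have "2 \<le> p" by (simp add: p_def Suc_le_eq zero_less_binomial)
  interpret pair_graph "thick_path n p" by (rule pair_graph_thick_path)
  have "\<not> nonrep_choosable (thick_path n p) l"
    by (rule not_nonrep_choosable_thick_path[OF M n_def \<open>0 < n\<close> p_def])
  then have "l < thue_choice_number (thick_path n p)"
    by (intro less_thue_choice_number) simp_all
  then show ?thesis
    using pathwidth_thick_path[OF \<open>0 < n\<close> \<open>2 \<le> p\<close>] pair_graph_thick_path
    by (intro exI[of _ "thick_path n p"]) simp
qed

end
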